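(* For each integer $n \geq 4$, let $f(n)$ be the least number of edges missing from any $n$-vertex graph $G$ with $q^*(G)>0$, that is, $f(n)=\min\{\binom{n}{2}-e(G) : G \text{ a simple graph on } n \text{ vertices with } q^*(G)>0\}$. Then for each $n \geq 4$ we have $f(n)=\lfloor n/2 \rfloor +1$.
   Context: All graphs are finite and simple. For a graph $G=(V,E)$ with $m \geq 1$ edges, degrees $d_v$, for $A\subseteq V$ let ${\rm vol}(A)=\sum_{v\in A} d_v$ and let $e(A)$ be the number of edges with both ends in $A$. For a partition $\mathcal{A}$ of $V$, the modularity score is $q_{\mathcal A}(G)=\frac{1}{m}\sum_{A\in\mathcal A} e(A)-\frac{1}{4m^2}\sum_{A\in\mathcal A}{\rm vol}(A)^2$, and the modularity of $G$ is $q^*(G)=\max_{\mathcal A} q_{\mathcal A}(G)$ over all vertex partitions. By convention a graph with no edges has $q^*(G)=0$. *)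

theory Defs
  imports Complex_Main "HOL-Library.Disjoint_Sets"
begin

text \<open>A graph is given by a vertex set and a set of edges, each edge being a two-element
  set of vertices.\<close>

definition simple_graph :: "'a set \<Rightarrow> 'a set set \<Rightarrow> bool" where
  "simple_graph V E \<longleftrightarrow> finite V \<and> (\<forall>e\<in>E. e \<subseteq> V \<and> card e = 2)"

definition degree :: "'a set set \<Rightarrow> 'a \<Rightarrow> nat" where
  "degree E v = card {e \<in> E. v \<in> e}"

definition vol :: "'a set set \<Rightarrow> 'a set \<Rightarrow> nat" where
  "vol E A = (\<Sum>v\<in>A. degree E v)"

definition edges_inside :: "'a set set \<Rightarrow> 'a set \<Rightarrow> nat" where
  "edges_inside E A = card {e \<in> E. e \<subseteq> A}"

definition modularity_score :: "'a set set \<Rightarrow> 'a set set \<Rightarrow> real" where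
  "modularity_score E P =
     (1 / real (card E)) * (\<Sum>A\<in>P. real (edges_inside E A))
     - (1 / (4 * real (card E) ^ 2)) * (\<Sum>A\<in>P. real (vol E A) ^ 2)"

definition modularity :: "'a set \<Rightarrow> 'a set set \<Rightarrow> real" where
  "modularity V E =
     (if E = {} then 0 else Max {modularity_score E P | P. partition_on V P})"

text \<open>Every finite graph is isomorphic to one whose vertices are natural numbers, so nothing
  is lost by taking the minimum over those. The natural-number subtraction does not truncate,
  because a simple graph on \<open>n\<close> vertices has at most \<open>n choose 2\<close> edges; for the same reason the
  set is finite.\<close>

definition min_missing_edges :: "nat \<Rightarrow> nat" where
  "min_missing_edges n =
     Min {(n choose 2) - card E | (V :: nat set) E.
            simple_graph V E \<and> card V = n \<and> modularity V E > 0}"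

end

theory Submission
  imports Defs
begin

text \<open>Split \<open>V\<close> into \<open>A\<close> and \<open>B\<close> of sizes \<open>a\<close> and \<open>b\<close>, and let \<open>e\<close>, \<open>f\<close>, \<open>c\<close> be the numbers
  of edges inside \<open>A\<close>, inside \<open>B\<close> and between them. Then \<open>4 m e(A) - vol(A)\<^sup>2 = 4 e f - c\<^sup>2\<close>, so
  the modularity is positive iff \<open>4 e f > c\<^sup>2\<close> for some split. If \<open>h\<close> edges are missing, then
  \<open>4 e f \<le> a b (a - 1) (b - 1)\<close> and \<open>c \<ge> a b - h\<close>, which excludes a positive value when
  \<open>2 h \<le> n\<close>. Conversely, remove \<open>n div 2 + 1\<close> edges, all between two halves, from the
  complete graph.\<close>

section \<open>Edge counts and volumes across a split of the vertex set\<close>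

text \<open>Counts the edges joining \<open>A\<close> to \<open>B\<close> only if \<open>A\<close> and \<open>B\<close> partition the vertex set.\<close>

definition edges_between :: "'a set set \<Rightarrow> 'a set \<Rightarrow> 'a set \<Rightarrow> nat" where
  "edges_between E A B = card {e \<in> E. \<not> e \<subseteq> A \<and> \<not> e \<subseteq> B}"

lemma edges_between_commute: "edges_between E A B = edges_between E B A"
  unfolding edges_between_def by (simp add: conj_commute)

lemma simple_graph_finite_edges:
  assumes "simple_graph V E"
  shows "finite E"
proof -
  have "E \<subseteq> Pow V" "finite V"
    using assms by (auto simp: simple_graph_def)
  then show ?thesis
    by (meson finite_Pow_iff finite_subset)
qed

lemma real_choose_two: "2 * real (n choose 2) = real n * (real n - 1)"
  by (induction n) (auto simp: numeral_2_eq_2 algebra_simps)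

lemma two_times_choose_two: "2 * (n choose 2) = n * (n - 1)"
  by (cases n) (simp_all add: choose_two)

lemma card_edges_split:
  assumes "simple_graph V E" "V = A \<union> B" "A \<inter> B = {}"
  shows "card E = edges_inside E A + edges_inside E B + edges_between E A B"
proof -
  have fin: "finite E"
    using assms(1) by (rule simple_graph_finite_edges)
  have disj: "\<not> (e \<subseteq> A \<and> e \<subseteq> B)" if "e \<in> E" for e
  proof
    assume "e \<subseteq> A \<and> e \<subseteq> B"
    then have "e = {}" using assms(3) by blast
    then show False using assms(1) that by (auto simp: simple_graph_def)
  qed
  have "E = ({e \<in> E. e \<subseteq> A} \<union> {e \<in> E. e \<subseteq> B}) \<union> {e \<in> E. \<not> e \<subseteq> A \<and> \<not> e \<subseteq> B}"
    by blast
  then have "card E =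
      card (({e \<in> E. e \<subseteq> A} \<union> {e \<in> E. e \<subseteq> B}) \<union> {e \<in> E. \<not> e \<subseteq> A \<and> \<not> e \<subseteq> B})"
    by (rule arg_cong)
  also have "\<dots> =
      card ({e \<in> E. e \<subseteq> A} \<union> {e \<in> E. e \<subseteq> B}) + card {e \<in> E. \<not> e \<subseteq> A \<and> \<not> e \<subseteq> B}"
    using fin by (intro card_Un_disjoint) auto
  also have "card ({e \<in> E. e \<subseteq> A} \<union> {e \<in> E. e \<subseteq> B}) =
      card {e \<in> E. e \<subseteq> A} + card {e \<in> E. e \<subseteq> B}"
    using fin disj by (intro card_Un_disjoint) auto
  finally show ?thesis
    by (simp add: edges_inside_def edges_between_def)
qed

text \<open>Double counting of the pairs \<open>v \<in> e\<close> with \<open>v \<in> A\<close>: an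
  edge contributes 2 if it lies in \<open>A\<close>, 1 if it crosses, and 0 otherwise.\<close>

lemma vol_eq_edges:
  assumes "simple_graph V E" "V = A \<union> B" "A \<inter> B = {}"
  shows "vol E A = 2 * edges_inside E A + edges_between E A B"
proof -
  have fin: "finite E" "finite A"
    using assms simple_graph_finite_edges[OF assms(1)] by (auto simp: simple_graph_def)
  have card_Int: "card (e \<inter> A) =
      (if e \<subseteq> A then 2 else 0) + (if \<not> e \<subseteq> A \<and> \<not> e \<subseteq> B then 1 else 0)" if "e \<in> E" for e
  proof -
    have "e \<subseteq> A \<union> B" "card e = 2"
      using assms that by (auto simp: simple_graph_def)
    then obtain u v where "e = {u, v}" "u \<noteq> v" "u \<in> A \<union> B" "v \<in> A \<union> B"
      by (auto simp: card_2_iff)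
    then show ?thesis
      using assms(3) by (cases "u \<in> A"; cases "v \<in> A") (auto simp: Int_insert_left)
  qed
  have "vol E A = (\<Sum>v\<in>A. \<Sum>e\<in>E. if v \<in> e then 1 else 0)"
    unfolding vol_def degree_def using fin by (simp add: sum.If_cases Int_def)
  also have "\<dots> = (\<Sum>e\<in>E. \<Sum>v\<in>A. if v \<in> e then 1 else 0)"
    by (rule sum.swap)
  also have "\<dots> = (\<Sum>e\<in>E. card (e \<inter> A))"
    using fin by (simp add: sum.If_cases Int_def conj_commute)
  also have "\<dots> = (\<Sum>e\<in>E. (if e \<subseteq> A then 2 else 0)
      + (if \<not> e \<subseteq> A \<and> \<not> e \<subseteq> B then 1 else 0))"
    using card_Int by (intro sum.cong) auto
  also have "\<dots> = 2 * edges_inside E A + edges_between E A B"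
    unfolding sum.distrib edges_inside_def edges_between_def
    using fin by (simp add: sum.If_cases Int_def)
  finally show ?thesis .
qed

lemma edges_inside_le:
  assumes "simple_graph V E" "A \<subseteq> V"
  shows "edges_inside E A \<le> card A choose 2"
proof -
  have "finite A"
    using assms by (auto simp: simple_graph_def intro: finite_subset)
  moreover have "{e \<in> E. e \<subseteq> A} \<subseteq> {e. e \<subseteq> A \<and> card e = 2}"
    using assms by (auto simp: simple_graph_def)
  ultimately show ?thesis
    unfolding edges_inside_def n_subsets[OF \<open>finite A\<close>, symmetric]
    by (intro card_mono) auto
qed

section \<open>Modularity scores over a common denominator\<close>

text \<open>Clearing denominators leaves one term per part, so the sign of a score can be judged
  part by part. Without edges both sides are 0, as division by zero gives 0.\<close>

lemma modularity_score_eq: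
  "modularity_score E P =
     (\<Sum>A\<in>P. 4 * real (card E) * real (edges_inside E A) - (real (vol E A))\<^sup>2)
       / (4 * (real (card E))\<^sup>2)"
proof (cases "card E = 0")
  case False
  then show ?thesis
    unfolding modularity_score_def sum_subtractf sum_distrib_left[symmetric]
    by (simp add: field_simps power2_eq_square)
qed (simp add: modularity_score_def)

lemma finite_modularity_scores:
  assumes "finite V"
  shows "finite {modularity_score E P | P. partition_on V P}"
proof -
  have "{P. partition_on V P} \<subseteq> Pow (Pow V)"
    by (auto simp: partition_on_def)
  then have "finite {P. partition_on V P}"
    using assms by (meson finite_Pow_iff finite_subset)
  then show ?thesis
    by simp
qed

section \<open>Few missing edges force nonpositive modularity\<close>

text \<open>The inequality behind the lower bound, over the reals. The disjunctions in the
  hypotheses record what is known from \<open>a\<close>, \<open>b\<close> and \<open>2 * h\<close>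
  being integers.\<close>

lemma few_missing_edges_imp_le:
  fixes a b h c e f :: real
  assumes "a = 0 \<or> 1 \<le> a" "b = 0 \<or> 1 \<le> b" "0 \<le> e" "0 \<le> f"
    and "2 * e \<le> a * (a - 1)" "2 * f \<le> b * (b - 1)"
    and "a * b - h \<le> c"
    and h: "2 * h \<le> a + b - 1 \<or> 2 * h = a + b"
  shows "4 * e * f \<le> c\<^sup>2"
proof (cases "a = 0 \<or> b = 0")
  case True
  then have "e = 0 \<or> f = 0"
    using assms by auto
  then show ?thesis by auto
next
  case False
  then have ab: "1 \<le> a" "1 \<le> b"
    using assms by auto
  \<comment> \<open>The lower bound on \<open>c\<close> may be squared only if it is nonnegative,
    which follows from \<open>h \<le> (a + b) / 2 \<le> a + b - 1 \<le> a * b\<close>.\<close>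
  have "0 \<le> (a - 1) * (b - 1)"
    using ab by simp
  then have "a + b - 1 \<le> a * b"
    by (simp add: algebra_simps)
  moreover have "2 * h \<le> a + b"
    using h by auto
  ultimately have nonneg: "0 \<le> a * b - h"
    using ab by linarith
  have "4 * e * f = (2 * e) * (2 * f)"
    by simp
  also have "\<dots> \<le> (a * (a - 1)) * (b * (b - 1))"
    by (rule mult_mono[OF assms(5,6)]) (use assms(4) ab in simp_all)
  also have "\<dots> \<le> (a * b - h)\<^sup>2"
  proof -
    \<comment> \<open>This expression is the right side minus the left side, expanded. If
      \<open>2 * h = a + b\<close> it is a perfect square.\<close>
    have "0 \<le> a * b * (a + b - 1 - 2 * h) + h\<^sup>2"
      using h
    proof
      assume "2 * h \<le> a + b - 1"
      then show ?thesis using ab by simp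
    next
      assume "2 * h = a + b"
      then have h_eq: "h = (a + b) / 2" by simp
      have "a * b * (a + b - 1 - 2 * h) + h\<^sup>2 = ((a - b) / 2)\<^sup>2"
        unfolding h_eq by (simp add: power2_eq_square field_simps)
      then show ?thesis by simp
    qed
    then show ?thesis
      by (simp add: power2_eq_square algebra_simps)
  qed
  also have "\<dots> \<le> c\<^sup>2"
    using nonneg assms(7) by (intro power_mono) auto
  finally show ?thesis .
qed

text \<open>Each part is compared with its own complement, so partitions into any number of parts
  reduce to two-part splits.\<close>

lemma inside_le_vol_if_few_missing:
  assumes G: "simple_graph V E" and A: "A \<subseteq> V"
    and few: "2 * ((card V choose 2) - card E) \<le> card V"
  shows "4 * real (card E) * real (edges_inside E A) \<le> (real (vol E A))\<^sup>2"
proof -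
  define B where "B = V - A"
  have V: "V = A \<union> B" "A \<inter> B = {}"
    using A by (auto simp: B_def)
  have fin: "finite A" "finite B"
    using G V by (auto simp: simple_graph_def)
  have n: "card V = card A + card B"
    using V fin by (simp add: card_Un_disjoint)
  let ?a = "real (card A)" and ?b = "real (card B)"
  let ?e = "real (edges_inside E A)" and ?f = "real (edges_inside E B)"
  let ?c = "real (edges_between E A B)"
  have m: "real (card E) = ?e + ?f + ?c"
    using card_edges_split[OF G V] by simp
  have vol: "real (vol E A) = 2 * ?e + ?c"
    using vol_eq_edges[OF G V] by simp
  have e: "?e \<le> real (card A choose 2)"
    using edges_inside_le[OF G A] by simp
  have f: "?f \<le> real (card B choose 2)"
    using edges_inside_le[OF G, of B] V by simp
  define h where "h = (card V choose 2) - card E"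
  \<comment> \<open>Natural subtraction only increases the difference, and this direction suffices
    to bound the crossing edges from below.\<close>
  have h: "real (card V choose 2) - real (card E) \<le> real h"
    unfolding h_def by linarith
  have sum: "2 * real (card V choose 2) = 
      2 * real (card A choose 2) + 2 * real (card B choose 2) + 2 * (?a * ?b)"
    unfolding real_choose_two n by (simp add: algebra_simps)
  have "4 * ?e * ?f \<le> ?c\<^sup>2"
  proof (rule few_missing_edges_imp_le)
    show "?a = 0 \<or> 1 \<le> ?a" "?b = 0 \<or> 1 \<le> ?b"
      by auto
    show "2 * ?e \<le> ?a * (?a - 1)" "2 * ?f \<le> ?b * (?b - 1)"
      using e f by (simp_all flip: real_choose_two)
    \<comment> \<open>A complete graph has \<open>?a * ?b\<close> crossing edges; at worst all the
      missing edges are among them.\<close>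
    show "?a * ?b - real h \<le> ?c"
      using m e f h sum by linarith
    have "2 * h + 1 \<le> card A + card B \<or> 2 * h = card A + card B"
      using few n by (auto simp: h_def)
    then show "2 * real h \<le> ?a + ?b - 1 \<or> 2 * real h = ?a + ?b"
      by linarith
  qed auto
  then show ?thesis
    unfolding m vol by (simp add: power2_eq_square algebra_simps)
qed

lemma modularity_nonpos_if_few_missing:
  assumes G: "simple_graph V E"
    and few: "2 * ((card V choose 2) - card E) \<le> card V"
  shows "modularity V E \<le> 0"
proof (cases "E = {}")
  case True
  then show ?thesis by (simp add: modularity_def)
next
  case False
  have finV: "finite V"
    using G by (simp add: simple_graph_def)
  have "V \<noteq> {}"
    using G False by (fastforce simp: simple_graph_def)
  \<comment> \<open>The one-part partition makes the set under \<open>Max\<close> nonempty.\<close>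
  then have "partition_on V {V}"
    by (simp add: partition_on_space)
  then have "{modularity_score E P | P. partition_on V P} \<noteq> {}"
    by blast
  moreover have "modularity_score E P \<le> 0" if P: "partition_on V P" for P
  proof -
    have "(\<Sum>A\<in>P. 4 * real (card E) * real (edges_inside E A)) \<le> (\<Sum>A\<in>P. (real (vol E A))\<^sup>2)"
      using P inside_le_vol_if_few_missing[OF G _ few]
      by (intro sum_mono) (auto simp: partition_on_def)
    then show ?thesis
      by (simp add: modularity_score_eq sum_subtractf divide_le_0_iff)
  qed
  ultimately show ?thesis
    using False finite_modularity_scores[OF finV]
    by (auto simp: modularity_def Max_le_iff)
qed

section \<open>A graph with positive modularity\<close>

text \<open>Both parts contribute the same amount \<open>4 * e * f - c\<^sup>2\<close> to the
  numerator of the score of \<open>{A, B}\<close>, where \<open>e\<close>, \<open>f\<close>,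
  \<open>c\<close> count the edges inside \<open>A\<close>, inside \<open>B\<close> and between
  them.\<close>

lemma modularity_pos_if_bipartition:
  assumes G: "simple_graph V E" and V: "V = A \<union> B" "A \<inter> B = {}"
    and less: "(edges_between E A B)\<^sup>2 < 4 * edges_inside E A * edges_inside E B"
  shows "modularity V E > 0"
proof -
  let ?e = "real (edges_inside E A)" and ?f = "real (edges_inside E B)"
  let ?c = "real (edges_between E A B)"
  \<comment> \<open>The strict inequality excludes an empty side. Hence \<open>A\<close> and
    \<open>B\<close> are distinct, and the sum over \<open>{A, B}\<close> really has two
    terms.\<close>
  have pos: "edges_inside E A > 0" "edges_inside E B > 0"
    using less by (auto intro: Nat.gr0I)
  have m: "real (card E) = ?e + ?f + ?c"
    using card_edges_split[OF G V] by simp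
  then have mpos: "real (card E) > 0"
    using pos by simp
  then have "E \<noteq> {}" by auto
  have nonempty: "A \<noteq> {}" "B \<noteq> {}"
  proof -
    have "edges_inside E {} = 0"
      using G by (auto simp: edges_inside_def simple_graph_def)
    then show "A \<noteq> {}" "B \<noteq> {}"
      using pos by auto
  qed
  then have part: "partition_on V {A, B}" and "A \<noteq> B"
    using V by (auto simp: partition_on_def disjoint_def)
  have volA: "real (vol E A) = 2 * ?e + ?c"
    using vol_eq_edges[OF G V] by simp
  have volB: "real (vol E B) = 2 * ?f + ?c"
    using vol_eq_edges[OF G, of B A] V edges_between_commute[of E A B]
    by (simp add: Un_commute Int_commute)
  have lt: "?c\<^sup>2 < 4 * ?e * ?f"
    using less by (metis of_nat_less_iff of_nat_mult of_nat_numeral of_nat_power)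
  have "(2 * ?e + ?c)\<^sup>2 + (2 * ?f + ?c)\<^sup>2 < 4 * (?e + ?f + ?c) * (?e + ?f)"
    using lt by (simp add: power2_eq_square algebra_simps)
  then have "(real (vol E A))\<^sup>2 + (real (vol E B))\<^sup>2 < 4 * real (card E) * (?e + ?f)"
    by (simp only: m volA volB)
  then have "0 < modularity_score E {A, B}"
    using mpos \<open>A \<noteq> B\<close> by (simp add: modularity_score_eq algebra_simps)
  also have "\<dots> \<le> modularity V E"
    using \<open>E \<noteq> {}\<close> finite_modularity_scores[of V E] part G
    by (auto simp: modularity_def simple_graph_def intro!: Max_ge)
  finally show ?thesis .
qed

text \<open>For even \<open>n\<close>, \<open>c = k * (k - 1) - 1\<close> while
  \<open>4 * e * f = (k * (k - 1))\<^sup>2\<close>. For odd \<open>n\<close>,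
  \<open>c = k\<^sup>2 - 1\<close> while
  \<open>4 * e * f = k\<^sup>2 * (k\<^sup>2 - 1)\<close>.\<close>

lemma half_split_missing_ineq:
  fixes n k c e f :: nat
  assumes "n \<ge> 4" and "k = n div 2"
    and "c + (k + 1) = k * (n - k)"
    and "2 * e = k * (k - 1)" and "2 * f = (n - k) * (n - k - 1)"
  shows "c\<^sup>2 < 4 * e * f"
proof -
  have k: "k \<ge> 2"
    using assms(1,2) by linarith
  have "4 * e * f = (2 * e) * (2 * f)"
    by simp
  then have ef: "4 * e * f = k * (k - 1) * ((n - k) * (n - k - 1))"
    using assms by simp
  \<comment> \<open>Writing \<open>k\<close> as \<open>j + 2\<close> removes the natural
    subtractions and builds in \<open>k \<ge> 2\<close>, so that only polynomials in
    \<open>j\<close> are compared.\<close>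
  obtain j where j: "k = j + 2"
    using k by (metis add.commute le_Suc_ex)
  consider "n - k = k" | "n - k = k + 1"
    using assms by linarith
  then show ?thesis
  proof cases
    case 1
    then have "c = j * j + 3 * j + 1"
      using assms(3) by (simp add: j algebra_simps)
    then show ?thesis
      unfolding ef 1 by (simp add: j power2_eq_square algebra_simps)
  next
    case 2
    then have "c = j * j + 4 * j + 3"
      using assms(3) by (simp add: j algebra_simps)
    then show ?thesis
      unfolding ef 2 by (simp add: j power2_eq_square algebra_simps)
  qed
qed

text \<open>\<open>K\<close> is the complete graph, \<open>X\<close> its edges crossing between the
  halves \<open>A\<close> and \<open>B\<close>, and \<open>H\<close> the crossing edges to be
  deleted.\<close>

lemma exists_graph_modularity_pos:
  assumes n: "n \<ge> 4"
  shows "\<exists>(V :: nat set) E. simple_graph V E \<and> card V = n \<and> modularity V E > 0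
           \<and> (n choose 2) - card E = n div 2 + 1"
proof -
  define k where "k = n div 2"
  define V where "V = {..<n}"
  define A where "A = {..<k}"
  define B where "B = {k..<n}"
  define K where "K = {e. e \<subseteq> V \<and> card e = 2}"
  define X where "X = {e \<in> K. \<not> e \<subseteq> A \<and> \<not> e \<subseteq> B}"
  have V: "V = A \<union> B" "A \<inter> B = {}"
    using n by (auto simp: V_def A_def B_def k_def)
  have card_AB: "card A = k" "card B = n - k" "card V = n"
    by (auto simp: A_def B_def V_def)
  have K: "simple_graph V K"
    by (auto simp: simple_graph_def K_def V_def)
  \<comment> \<open>Deleting edges that leave \<open>S\<close> keeps \<open>S\<close> complete. The
    case \<open>H = {}\<close> serves to count \<open>X\<close>; the chosen \<open>H\<close> is used
    later.\<close>
  have inside: "edges_inside (K - H) S = card S choose 2"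
    if "S \<subseteq> V" "\<And>e. e \<in> H \<Longrightarrow> \<not> e \<subseteq> S" for S H
  proof -
    have "{e \<in> K - H. e \<subseteq> S} = {e. e \<subseteq> S \<and> card e = 2}"
      using that by (auto simp: K_def)
    moreover have "finite S"
      using that(1) finite_subset by (auto simp: V_def)
    ultimately show ?thesis
      by (simp add: edges_inside_def n_subsets)
  qed
  have sub: "A \<subseteq> V" "B \<subseteq> V"
    using V by auto
  have cK: "card K = n choose 2"
    unfolding K_def using n_subsets[of V 2] by (simp add: V_def)
  have "card K = (k choose 2) + ((n - k) choose 2) + card X"
    using card_edges_split[OF K V] inside[of A "{}"] inside[of B "{}"] sub
    by (simp add: card_AB edges_between_def X_def)
  moreover have "2 * real (n choose 2) =
      2 * real (k choose 2) + 2 * real ((n - k) choose 2) + 2 * (real k * real (n - k))"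
    unfolding real_choose_two by (simp add: k_def of_nat_diff algebra_simps)
  ultimately have "real (card X) = real (k * (n - k))"
    unfolding cK by simp
  then have cX: "card X = k * (n - k)"
    by (simp only: of_nat_eq_iff)
  \<comment> \<open>Since \<open>n \<ge> 4\<close> gives \<open>k \<ge> 2\<close>, there are enough
    crossing edges to delete \<open>k + 1\<close> of them.\<close>
  have "k + 1 \<le> k * 2" "k * 2 \<le> k * (n - k)"
    using n by (auto simp: k_def)
  then have k_le: "k + 1 \<le> k * (n - k)"
    by (rule le_trans)
  then obtain H where H: "H \<subseteq> X" "card H = k + 1"
    using cX by (metis le_trans obtain_subset_with_card_n)
  define E where "E = K - H"
  have HK: "H \<subseteq> K"
    using H by (auto simp: X_def)
  have finK: "finite K"
    using K by (rule simple_graph_finite_edges)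
  have finH: "finite H"
    using HK finK by (rule finite_subset)
  \<comment> \<open>Ensures that subtracting \<open>card E\<close> from \<open>n choose 2\<close>
    gives back exactly \<open>k + 1\<close>.\<close>
  have le: "k + 1 \<le> card K"
    using card_mono[OF finK HK] H by simp
  have cE: "card E = card K - (k + 1)"
    unfolding E_def using card_Diff_subset[OF finH HK] H by simp
  have G: "simple_graph V E"
    using K by (auto simp: E_def simple_graph_def)
  have "{e \<in> E. \<not> e \<subseteq> A \<and> \<not> e \<subseteq> B} = X - H"
    by (auto simp: E_def X_def)
  then have c: "edges_between E A B + (k + 1) = k * (n - k)"
    using card_Diff_subset[OF finH H(1)] H cX k_le
    by (simp only: edges_between_def le_add_diff_inverse2)
  have "\<not> e \<subseteq> A" "\<not> e \<subseteq> B" if "e \<in> H" for e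
    using H that by (auto simp: X_def)
  then have e: "edges_inside E A = k choose 2" "edges_inside E B = (n - k) choose 2"
    unfolding E_def using inside[of A H] inside[of B H] sub
    by (simp_all add: card_AB)
  have "(edges_between E A B)\<^sup>2 < 4 * edges_inside E A * edges_inside E B"
    unfolding e using n k_def c
    by (rule half_split_missing_ineq) (rule two_times_choose_two)+
  then have "modularity V E > 0"
    using G V by (intro modularity_pos_if_bipartition)
  moreover have "(n choose 2) - card E = n div 2 + 1"
    using cE le by (simp add: cK k_def)
  ultimately show ?thesis
    using G card_AB by blast
qed

section \<open>The minimum number of missing edges\<close>

theorem theorem1p1:
  fixes n :: nat
  assumes "n \<ge> 4"
  shows "min_missing_edges n = n div 2 + 1"
  unfolding min_missing_edges_def
proof (rule Min_eqI)
  show "finite {(n choose 2) - card E | (V :: nat set) E.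
      simple_graph V E \<and> card V = n \<and> modularity V E > 0}"
    by (rule finite_subset[of _ "{..n choose 2}"]) auto
  show "n div 2 + 1 \<in> {(n choose 2) - card E | (V :: nat set) E.
      simple_graph V E \<and> card V = n \<and> modularity V E > 0}"
    using exists_graph_modularity_pos[OF assms] by (smt (verit) mem_Collect_eq)
next
  fix y
  assume "y \<in> {(n choose 2) - card E | (V :: nat set) E.
      simple_graph V E \<and> card V = n \<and> modularity V E > 0}"
  then obtain V :: "nat set" and E where VE: "y = (n choose 2) - card E"
      "simple_graph V E" "card V = n" "modularity V E > 0"
    by blast
  \<comment> \<open>Otherwise \<open>y \<le> n div 2\<close>, that is \<open>2 * y \<le> n\<close>,
    and the modularity would be nonpositive.\<close>
  show "n div 2 + 1 \<le> y"
    using modularity_nonpos_if_few_missing[of V E] VE by fastforce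
qed

end
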